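(* Let $G$ be a locally compact group, let $\pi:G\to\mathcal{U}(\mathcal{H}_{\pi})$ and $\rho:G\to\mathcal{U}(\mathcal{H}_{\rho})$ be square integrable representations, and let $g\in\mathcal{H}_{\pi}$ and $h\in\mathcal{H}_{\rho}$ be admissible vectors. Then $\mathcal{W}_{g}g-\mathcal{W}_{h}h$ is never a non-zero function of positive type; that is, if $\mathcal{W}_{g}g-\mathcal{W}_{h}h$ is a function of positive type on $G$, then it is identically zero.
   Context: Locally compact groups are Hausdorff, $L^2(G)$ is taken with respect to a fixed left Haar measure, and inner products are linear in the first argument. A unitary representation $\pi:G\to\mathcal{U}(\mathcal{H}_{\pi})$ is a group homomorphism into the unitary operators of a Hilbert space such that for all $f,g\in\mathcal{H}_\pi$ the function (wavelet transform) $\mathcal{W}_{g}f(x):=\langle f,\pi(x)g\rangle_{\mathcal{H}_\pi}$ is continuous on $G$. It is irreducible if its only closed invariant subspaces are $\{0\}$ and $\mathcal{H}_\pi$. A square integrable representation is an irreducible unitary representation $\pi$ for which there is a non-zero $g\in\mathcal{H}_\pi$ with $\mathcal{W}_g g\in L^2(G)$; such a $g$ is called a square integrable vector. By the Duflo-Moore theorem there is a unique positive, densely defined, injective operator $C_\pi$ on $\mathcal{H}_\pi$, whose domain consists of $0$ and the square integrable vectors, with $\langle\mathcal{W}_{g_1}f_1,\mathcal{W}_{g_2}f_2\rangle_{L^2(G)}=\langle f_1,f_2\rangle\,\overline{\langle C_\pi g_1,C_\pi g_2\rangle}$ for all $f_1,f_2\in\mathcal{H}_\pi$ and $g_1,g_2\in\mathrm{dom}(C_\pi)$.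 A square integrable vector $g$ is admissible if $\|C_\pi g\|=1$; equivalently, $\mathcal{W}_g:\mathcal{H}_\pi\to L^2(G)$ is an isometry. A function $f:G\to\mathbb{C}$ is of positive type if for every finite subset $\{x_1,\dots,x_m\}\subset G$ the matrix $\{f(x_j^{-1}x_i)\}_{i,j=1}^m$ is positive semi-definite. *)

theory Defs
  imports "HOL-Analysis.Analysis" "HOL-Algebra.Coset"
begin

text \<open>A complex inner product, linear in the first argument, is put on top of the class
  \<^class>\<open>real_inner\<close>, whose norm, metric and topology are reused. Since the real inner product
  is required to be the real part of the complex one, the norm is \<open>norm x = sqrt (Re (cinner x x))\<close>
  and the positive definiteness of \<open>cinner\<close> is inherited from \<^class>\<open>real_inner\<close>.\<close>

class complex_inner = real_inner +
  fixes scaleC :: "complex \<Rightarrow> 'a \<Rightarrow> 'a"  (infixr "*\<^sub>C" 75)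
    and cinner :: "'a \<Rightarrow> 'a \<Rightarrow> complex"
  assumes scaleC_add_right: "a *\<^sub>C (x + y) = a *\<^sub>C x + a *\<^sub>C y"
    and scaleC_add_left: "(a + b) *\<^sub>C x = a *\<^sub>C x + b *\<^sub>C x"
    and scaleC_scaleC: "a *\<^sub>C b *\<^sub>C x = (a * b) *\<^sub>C x"
    and scaleR_scaleC: "r *\<^sub>R x = complex_of_real r *\<^sub>C x"
    and cinner_add_left: "cinner (x + y) z = cinner x z + cinner y z"
    and cinner_scaleC_left: "cinner (a *\<^sub>C x) y = a * cinner x y"
    and cinner_commute: "cinner x y = cnj (cinner y x)"
    and inner_eq_Re_cinner: "inner x y = Re (cinner x y)"

class chilbert_space = complex_inner + complete_space

instantiation complex :: chilbert_space
begin

definition scaleC_complex :: "complex \<Rightarrow> complex \<Rightarrow> complex" where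
  "scaleC_complex a x = a * x"

definition cinner_complex :: "complex \<Rightarrow> complex \<Rightarrow> complex" where
  "cinner_complex x y = x * cnj y"

instance
  by standard
    (auto simp: scaleC_complex_def cinner_complex_def algebra_simps scaleR_conv_of_real
      inner_complex_def)

end

lemma cinner_self: "cinner x x = complex_of_real ((norm x)\<^sup>2)"
proof -
  have "Im (cinner x x) = - Im (cinner x x)"
    by (subst cinner_commute) simp
  then show ?thesis
    by (simp add: complex_eq_iff dot_square_norm flip: inner_eq_Re_cinner)
qed

definition csubspace :: "'h::complex_inner set \<Rightarrow> bool" where
  "csubspace S \<longleftrightarrow> 0 \<in> S \<and> (\<forall>x\<in>S. \<forall>y\<in>S. x + y \<in> S) \<and> (\<forall>a. \<forall>x\<in>S. a *\<^sub>C x \<in> S)"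

definition clinear_on :: "'h::complex_inner set \<Rightarrow> ('h \<Rightarrow> 'k::complex_inner) \<Rightarrow> bool" where
  "clinear_on S A \<longleftrightarrow>
     (\<forall>x\<in>S. \<forall>y\<in>S. A (x + y) = A x + A y) \<and> (\<forall>a. \<forall>x\<in>S. A (a *\<^sub>C x) = a *\<^sub>C A x)"

definition unitary_operator :: "('h::complex_inner \<Rightarrow> 'h) \<Rightarrow> bool" where
  "unitary_operator U \<longleftrightarrow>
     clinear_on UNIV U \<and> surj U \<and> (\<forall>x y. cinner (U x) (U y) = cinner x y)"

definition unitary_group :: "('h::complex_inner \<Rightarrow> 'h) monoid" where
  "unitary_group = \<lparr>carrier = {U. unitary_operator U}, mult = (\<circ>), one = id\<rparr>"

locale locally_compact_group = group G for G :: "('a, 'b) monoid_scheme" (structure) +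
  fixes T :: "'a topology"
  assumes topspace_eq_carrier: "topspace T = carrier G"
    and Hausdorff: "Hausdorff_space T"
    and locally_compact: "locally_compact_space T"
    and continuous_mult: "continuous_map (prod_topology T T) T (\<lambda>(x, y). x \<otimes> y)"
    and continuous_inv: "continuous_map T T (\<lambda>x. inv x)"

definition Radon_measure :: "'a topology \<Rightarrow> 'a measure \<Rightarrow> bool" where
  "Radon_measure T M \<longleftrightarrow>
     space M = topspace T \<and>
     sets M = sigma_sets (topspace T) {U. openin T U} \<and>
     (\<forall>K. compactin T K \<longrightarrow> emeasure M K < \<infinity>) \<and>
     (\<forall>A\<in>sets M. emeasure M A = (INF U\<in>{U. openin T U \<and> A \<subseteq> U}. emeasure M U)) \<and>
     (\<forall>U. openin T U \<longrightarrow> emeasure M U = (SUP K\<in>{K. compactin T K \<and> K \<subseteq> U}. emeasure M K))"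

definition left_Haar_measure ::
  "('a, 'b) monoid_scheme \<Rightarrow> 'a topology \<Rightarrow> 'a measure \<Rightarrow> bool" where
  "left_Haar_measure G T M \<longleftrightarrow>
     Radon_measure T M \<and> emeasure M (space M) \<noteq> 0 \<and>
     (\<forall>x\<in>carrier G. \<forall>A\<in>sets M. emeasure M (x <#\<^bsub>G\<^esub> A) = emeasure M A)"

definition L2 :: "'a measure \<Rightarrow> ('a \<Rightarrow> complex) set" where
  "L2 M = {f \<in> borel_measurable M. integrable M (\<lambda>x. (cmod (f x))\<^sup>2)}"

definition L2_inner :: "'a measure \<Rightarrow> ('a \<Rightarrow> complex) \<Rightarrow> ('a \<Rightarrow> complex) \<Rightarrow> complex" where
  "L2_inner M f g = (LINT x|M. f x * cnj (g x))"

definition wavelet_transform ::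
  "('a \<Rightarrow> 'h::complex_inner \<Rightarrow> 'h) \<Rightarrow> 'h \<Rightarrow> 'h \<Rightarrow> 'a \<Rightarrow> complex" where
  "wavelet_transform \<pi> g f x = cinner f (\<pi> x g)"

definition unitary_representation ::
  "('a, 'b) monoid_scheme \<Rightarrow> 'a topology \<Rightarrow> ('a \<Rightarrow> 'h::chilbert_space \<Rightarrow> 'h) \<Rightarrow> bool" where
  "unitary_representation G T \<pi> \<longleftrightarrow>
     \<pi> \<in> hom G unitary_group \<and>
     (\<forall>f g. continuous_map T euclidean (wavelet_transform \<pi> g f))"

definition irreducible_representation ::
  "('a, 'b) monoid_scheme \<Rightarrow> ('a \<Rightarrow> 'h::chilbert_space \<Rightarrow> 'h) \<Rightarrow> bool" where
  "irreducible_representation G \<pi> \<longleftrightarrow>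
     (\<forall>S. csubspace S \<and> closed S \<and> (\<forall>x\<in>carrier G. \<pi> x ` S \<subseteq> S) \<longrightarrow> S = {0} \<or> S = UNIV)"

definition square_integrable_vector ::
  "'a measure \<Rightarrow> ('a \<Rightarrow> 'h::chilbert_space \<Rightarrow> 'h) \<Rightarrow> 'h \<Rightarrow> bool" where
  "square_integrable_vector M \<pi> g \<longleftrightarrow> g \<noteq> 0 \<and> wavelet_transform \<pi> g g \<in> L2 M"

definition square_integrable_representation ::
  "('a, 'b) monoid_scheme \<Rightarrow> 'a topology \<Rightarrow> 'a measure \<Rightarrow> ('a \<Rightarrow> 'h::chilbert_space \<Rightarrow> 'h) \<Rightarrow> bool"
  where
  "square_integrable_representation G T M \<pi> \<longleftrightarrow>
     unitary_representation G T \<pi> \<and> irreducible_representation G \<pi> \<and>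
     (\<exists>g. square_integrable_vector M \<pi> g)"

text \<open>The Duflo--Moore operator is unbounded in general. It is encoded by a total function of
  which only the values on the domain \<open>dom C = insert 0 {g. square_integrable_vector M \<pi> g}\<close>
  matter.\<close>

definition Duflo_Moore_domain ::
  "'a measure \<Rightarrow> ('a \<Rightarrow> 'h::chilbert_space \<Rightarrow> 'h) \<Rightarrow> 'h set" where
  "Duflo_Moore_domain M \<pi> = insert 0 {g. square_integrable_vector M \<pi> g}"

definition Duflo_Moore_operator ::
  "'a measure \<Rightarrow> ('a \<Rightarrow> 'h::chilbert_space \<Rightarrow> 'h) \<Rightarrow> ('h \<Rightarrow> 'h) \<Rightarrow> bool" where
  "Duflo_Moore_operator M \<pi> C \<longleftrightarrow>
     (let D = Duflo_Moore_domain M \<pi> in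
       csubspace D \<and> closure D = UNIV \<and>
       clinear_on D C \<and> inj_on C D \<and> (\<forall>g\<in>D. cinner (C g) g \<in> \<real>\<^sub>\<ge>\<^sub>0) \<and>
       (\<forall>f. \<forall>g\<in>D. wavelet_transform \<pi> g f \<in> L2 M) \<and>
       (\<forall>f\<^sub>1 f\<^sub>2. \<forall>g\<^sub>1\<in>D. \<forall>g\<^sub>2\<in>D.
          L2_inner M (wavelet_transform \<pi> g\<^sub>1 f\<^sub>1) (wavelet_transform \<pi> g\<^sub>2 f\<^sub>2) =
          cinner f\<^sub>1 f\<^sub>2 * cnj (cinner (C g\<^sub>1) (C g\<^sub>2))))"

text \<open>The operator is quantified existentially; by the Duflo--Moore theorem it exists for every
  square integrable representation. The choice is immaterial: \<open>norm (C g)\<close> is the same for every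
  operator with the required properties, as the next lemma shows. For the same reason nothing is
  lost by asking only for \<open>\<langle>C g, g\<rangle> \<ge> 0\<close>, rather than for self-adjointness as well.\<close>

definition admissible_vector ::
  "'a measure \<Rightarrow> ('a \<Rightarrow> 'h::chilbert_space \<Rightarrow> 'h) \<Rightarrow> 'h \<Rightarrow> bool" where
  "admissible_vector M \<pi> g \<longleftrightarrow>
     square_integrable_vector M \<pi> g \<and> (\<exists>C. Duflo_Moore_operator M \<pi> C \<and> norm (C g) = 1)"

lemma Duflo_Moore_operator_norm_unique:
  assumes "Duflo_Moore_operator M \<pi> C" "Duflo_Moore_operator M \<pi> C'"
    and g: "square_integrable_vector M \<pi> g"
  shows "norm (C g) = norm (C' g)"
proof -
  have D: "g \<in> Duflo_Moore_domain M \<pi>"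
    using g by (simp add: Duflo_Moore_domain_def)
  have "cinner g g * cnj (cinner (C g) (C g)) = cinner g g * cnj (cinner (C' g) (C' g))"
    using assms(1,2) D unfolding Duflo_Moore_operator_def Let_def by metis
  moreover have "g \<noteq> 0"
    using g by (simp add: square_integrable_vector_def)
  ultimately have "(norm (C g))\<^sup>2 = (norm (C' g))\<^sup>2"
    by (simp add: cinner_self flip: of_real_power)
  then show ?thesis by simp
qed

lemma admissible_vector_isometry:
  assumes "admissible_vector M \<pi> g"
  shows "wavelet_transform \<pi> g f \<in> L2 M"
    and "L2_inner M (wavelet_transform \<pi> g f) (wavelet_transform \<pi> g f) = cinner f f"
proof -
  obtain C where C: "Duflo_Moore_operator M \<pi> C" "norm (C g) = 1"
    and D: "g \<in> Duflo_Moore_domain M \<pi>"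
    using assms by (auto simp: admissible_vector_def Duflo_Moore_domain_def)
  show "wavelet_transform \<pi> g f \<in> L2 M"
    and "L2_inner M (wavelet_transform \<pi> g f) (wavelet_transform \<pi> g f) = cinner f f"
    using C D by (simp_all add: Duflo_Moore_operator_def Let_def cinner_self)
qed

text \<open>Over the complex numbers, a nonnegative quadratic form already forces the matrix to be
  Hermitian.\<close>

definition pos_semidef_on :: "'i set \<Rightarrow> ('i \<Rightarrow> 'i \<Rightarrow> complex) \<Rightarrow> bool" where
  "pos_semidef_on I A \<longleftrightarrow>
     (\<forall>v. (\<Sum>i\<in>I. \<Sum>j\<in>I. cnj (v i) * A i j * v j) \<in> \<real>\<^sub>\<ge>\<^sub>0)"

definition positive_type :: "('a, 'b) monoid_scheme \<Rightarrow> ('a \<Rightarrow> complex) \<Rightarrow> bool" where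
  "positive_type G f \<longleftrightarrow>
     (\<forall>F. finite F \<and> F \<subseteq> carrier G \<longrightarrow>
        pos_semidef_on F (\<lambda>x y. f (inv\<^bsub>G\<^esub> y \<otimes>\<^bsub>G\<^esub> x)))"

end

theory Submission
  imports Defs
begin

text \<open>Write \<open>\<phi>\<^sub>g = \<W>\<^sub>g g\<close> and \<open>\<phi>\<^sub>h = \<W>\<^sub>h h\<close>. For finitely many points \<open>x\<close> and coefficients
  \<open>v x\<close>, the quadratic form of \<open>\<phi>\<^sub>g\<close> is \<open>\<parallel>\<Sum>x. v x \<pi>(x)g\<parallel>\<^sup>2\<close>, and likewise for \<open>\<phi>\<^sub>h\<close>. So if
  \<open>\<phi>\<^sub>g - \<phi>\<^sub>h\<close> is of positive type, then \<open>\<Sum>x. v x \<pi>(x)g \<mapsto> \<Sum>x. v x \<rho>(x)h\<close> is a contraction, and it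
  has an adjoint \<open>A\<close> from the space of \<open>\<rho>\<close> to the space of \<open>\<pi>\<close>, characterised by
  \<open>\<W>\<^sub>g (A f) = \<W>\<^sub>h f\<close>. In the language of reproducing kernels: domination of the kernels gives a
  contractive inclusion of the range of \<open>\<W>\<^sub>h\<close> in the range of \<open>\<W>\<^sub>g\<close>.

  Admissibility now upgrades the inclusion. Both transforms are isometries into the same space
  \<open>L\<^sup>2(G)\<close>, so \<open>A\<close> preserves inner products. It also intertwines \<open>\<rho>\<close> with \<open>\<pi>\<close>, so its range is a
  non-zero closed invariant subspace, and irreducibility of \<open>\<pi>\<close> makes \<open>A\<close> surjective. If
  \<open>g = A f\<close>, then for every \<open>f'\<close>
  \<open>\<langle>f', f\<rangle> = \<langle>A f', g\<rangle> = \<W>\<^sub>g (A f') 1 = \<W>\<^sub>h f' 1 = \<langle>f', h\<rangle>\<close>, that is \<open>f = h\<close>. Hence \<open>A h = g\<close> and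
  \<open>\<phi>\<^sub>g = \<W>\<^sub>g (A h) = \<W>\<^sub>h h = \<phi>\<^sub>h\<close>.\<close>

section \<open>Complex inner products\<close>

lemma cinner_add_right: "cinner x (y + z) = cinner x y + cinner x z"
  by (metis cinner_add_left cinner_commute complex_cnj_add)

lemma cinner_scaleC_right: "cinner x (a *\<^sub>C y) = cnj a * cinner x y"
  by (metis cinner_scaleC_left cinner_commute complex_cnj_mult)

lemma scaleC_zero_left [simp]: "0 *\<^sub>C (x::'v::complex_inner) = 0"
  using scaleR_scaleC[of 0 x] by simp

lemma scaleC_zero_right [simp]: "a *\<^sub>C (0::'v::complex_inner) = 0"
  using scaleC_add_right[of a 0 "0::'v"] by simp

lemma cinner_zero_left [simp]: "cinner 0 (x::'v::complex_inner) = 0"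
  using cinner_add_left[of 0 0 x] by simp

lemma cinner_zero_right [simp]: "cinner (x::'v::complex_inner) 0 = 0"
  using cinner_add_right[of x 0 0] by simp

lemma cinner_sum_left: "cinner (\<Sum>i\<in>I. u i) (y::'v::complex_inner) = (\<Sum>i\<in>I. cinner (u i) y)"
  by (induction I rule: infinite_finite_induct) (auto simp: cinner_add_left)

lemma cinner_sum_right: "cinner (y::'v::complex_inner) (\<Sum>i\<in>I. u i) = (\<Sum>i\<in>I. cinner y (u i))"
  by (induction I rule: infinite_finite_induct) (auto simp: cinner_add_right)

lemma eq_if_cinner_eq:
  fixes x y :: "'v::complex_inner"
  assumes "\<And>z. cinner z x = cinner z y"
  shows "x = y"
proof -
  have "inner z x = inner z y" for z
    using assms by (simp add: inner_eq_Re_cinner)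
  then show ?thesis
    by (metis vector_eq_rdot inner_commute)
qed

text \<open>The real inner product with \<open>u\<close> is the real part of the complex one, and the real inner product
  with \<open>\<i> u\<close> is its imaginary part, so a complex identity can be checked by real functionals.\<close>

lemma cinner_eq_if_inner_eq_multiples:
  fixes w u :: "'v::complex_inner" and f v :: "'w::complex_inner"
  assumes "\<And>a. inner w (a *\<^sub>C u) = inner f (a *\<^sub>C v)"
  shows "cinner w u = cinner f v"
  using assms[of 1] assms[of \<i>]
  by (simp add: inner_eq_Re_cinner cinner_scaleC_right complex_eq_iff)

text \<open>Norm and real scaling come from the complex structure, so a map that preserves \<open>cinner\<close> and
  is complex linear is covered by the theorem that isometric images of complete subspaces are
  complete.\<close>

lemma closed_range_if_cinner_preserving:
  fixes A :: "'k::chilbert_space \<Rightarrow> 'h::complex_inner"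
  assumes "clinear_on UNIV A" and iso: "\<And>x y. cinner (A x) (A y) = cinner x y"
  shows "closed (range A)"
proof -
  have norm: "norm (A x) = norm x" for x
    by (simp add: norm_eq_sqrt_inner inner_eq_Re_cinner iso)
  have "bounded_linear A"
    by (rule bounded_linear_intro[where K = 1])
      (use assms norm in \<open>auto simp: clinear_on_def scaleR_scaleC\<close>)
  then have "complete (range A)"
    by (intro complete_isometric_image[of 1]) (auto simp: norm complete_UNIV)
  then show ?thesis
    by (rule complete_imp_closed)
qed

section \<open>The adjoint of a contractive linear relation\<close>

text \<open>This is the Riesz representation theorem for the functional \<open>u \<mapsto> \<langle>f, v\<rangle>\<close>, where \<open>v\<close> is
  related to \<open>u\<close>. Contractivity makes a linear relation single-valued, but keeping it as a set of
  pairs spares the choice of representations of \<open>u\<close> and the extension to the closure of the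
  domain. The vector \<open>w\<close> is the limit of a minimising sequence for
  \<open>\<parallel>u\<parallel>\<^sup>2 - 2 \<langle>f, v\<rangle>\<close>, which is Cauchy by the parallelogram law. The infimum need not be attained on
  the relation, so the variational argument is carried out along the sequence.\<close>

lemma adjoint_vector_exists:
  fixes R :: "('h::{real_inner, complete_space} \<times> 'k::real_inner) set" and f :: 'k
  assumes R: "subspace R"
    and contractive: "\<And>u v. (u, v) \<in> R \<Longrightarrow> norm v \<le> norm u"
  shows "\<exists>w. \<forall>(u, v)\<in>R. inner w u = inner f v"
proof -
  define J where "J = (\<lambda>p::'h \<times> 'k. (norm (fst p))\<^sup>2 - 2 * inner f (snd p))"
  define m where "m = Inf (J ` R)"
  have bound: "- (norm f)\<^sup>2 \<le> J p" if "p \<in> R" for p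
  proof -
    have "inner f (snd p) \<le> norm f * norm (snd p)"
      by (rule norm_cauchy_schwarz)
    also have "\<dots> \<le> norm f * norm (fst p)"
      using contractive[of "fst p" "snd p"] that by (simp add: mult_left_mono)
    finally have "inner f (snd p) \<le> norm f * norm (fst p)" .
    moreover have "0 \<le> (norm f - norm (fst p))\<^sup>2"
      by simp
    ultimately show ?thesis
      unfolding J_def by (simp add: power2_eq_square algebra_simps)
  qed
  then have bdd: "bdd_below (J ` R)"
    by (intro bdd_belowI2)
  have m_le: "m \<le> J p" if "p \<in> R" for p
    unfolding m_def using that bdd by (simp add: cINF_lower)
  have "R \<noteq> {}"
    using subspace_0[OF R] by auto
  then have "\<exists>p\<in>R. J p < m + inverse (real (Suc n))" for n
    unfolding m_def using cINF_less_iff[OF _ bdd] by fastforce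
  then obtain p where pR: "\<And>n. p n \<in> R" and pJ: "\<And>n. J (p n) < m + inverse (real (Suc n))"
    by metis
  define u where "u = (\<lambda>n. fst (p n))"
  have midpoint: "(norm (fst q - fst q'))\<^sup>2 \<le> 2 * (J q - m) + 2 * (J q' - m)"
    if "q \<in> R" "q' \<in> R" for q q'
  proof -
    have "(1/2) *\<^sub>R (q + q') \<in> R"
      using R that by (simp add: subspace_add subspace_scale)
    then have "m \<le> J ((1/2) *\<^sub>R (q + q'))"
      by (rule m_le)
    then show ?thesis
      unfolding J_def power2_norm_eq_inner
      by (simp add: inner_simps inner_commute algebra_simps)
  qed
  have "Cauchy u"
  proof (rule metric_CauchyI)
    fix e :: real
    assume "0 < e"
    then obtain N where N: "inverse (real (Suc N)) < e\<^sup>2 / 4"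
      using reals_Archimedean[of "e\<^sup>2 / 4"] by auto
    have close: "J (p n) - m < e\<^sup>2 / 4" if "n \<ge> N" for n
    proof -
      have "inverse (real (Suc n)) \<le> inverse (real (Suc N))"
        using that by (intro le_imp_inverse_le) auto
      then show ?thesis
        using pJ[of n] N by linarith
    qed
    have "dist (u i) (u j) < e" if "i \<ge> N" "j \<ge> N" for i j
    proof -
      have "(dist (u i) (u j))\<^sup>2 \<le> 2 * (J (p i) - m) + 2 * (J (p j) - m)"
        unfolding u_def dist_norm by (rule midpoint[OF pR pR])
      also have "\<dots> < 2 * (e\<^sup>2 / 4) + 2 * (e\<^sup>2 / 4)"
        using close[OF that(1)] close[OF that(2)]
        by (intro add_strict_mono mult_strict_left_mono) auto
      also have "\<dots> = e\<^sup>2"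
        by simp
      finally have "(dist (u i) (u j))\<^sup>2 < e\<^sup>2" .
      then show ?thesis
        using \<open>0 < e\<close> by (simp add: power2_less_imp_less)
    qed
    then show "\<exists>M. \<forall>i\<ge>M. \<forall>j\<ge>M. dist (u i) (u j) < e"
      by blast
  qed
  then obtain w where w: "u \<longlonglongrightarrow> w"
    by (meson Cauchy_convergent convergent_def)
  have "inner w x = inner f y" if xy: "(x, y) \<in> R" for x y
  proof -
    define d where "d = inner w x - inner f y"
    have quadratic: "0 \<le> 2 * t * d + t\<^sup>2 * (norm x)\<^sup>2" for t
    proof (rule LIMSEQ_le_const)
      show "(\<lambda>n. inverse (real (Suc n)) + 2 * t * (inner (u n) x - inner f y) + t\<^sup>2 * (norm x)\<^sup>2)
          \<longlonglongrightarrow> 2 * t * d + t\<^sup>2 * (norm x)\<^sup>2"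
      proof -
        have "(\<lambda>n. inverse (real (Suc n)) + 2 * t * (inner (u n) x - inner f y) + t\<^sup>2 * (norm x)\<^sup>2)
            \<longlonglongrightarrow> 0 + 2 * t * (inner w x - inner f y) + t\<^sup>2 * (norm x)\<^sup>2"
          by (intro tendsto_add tendsto_mult tendsto_diff tendsto_inner tendsto_const
              LIMSEQ_inverse_real_of_nat w)
        then show ?thesis
          by (simp add: d_def)
      qed
      have "0 \<le> inverse (real (Suc n)) + 2 * t * (inner (u n) x - inner f y) + t\<^sup>2 * (norm x)\<^sup>2"
        for n
      proof -
        have "p n + t *\<^sub>R (x, y) \<in> R"
          using R pR xy by (simp only: subspace_add subspace_scale)
        then have "m \<le> J (p n + t *\<^sub>R (x, y))"
          by (rule m_le)
        also have "\<dots> = J (p n) + 2 * t * (inner (u n) x - inner f y) + t\<^sup>2 * (norm x)\<^sup>2"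
          unfolding J_def u_def power2_norm_eq_inner
          by (simp add: inner_simps inner_commute algebra_simps power2_eq_square)
        finally show ?thesis
          using pJ[of n] by linarith
      qed
      then show "\<exists>N. \<forall>n\<ge>N. 0 \<le> inverse (real (Suc n)) + 2 * t * (inner (u n) x - inner f y)
          + t\<^sup>2 * (norm x)\<^sup>2"
        by blast
    qed
    \<comment> \<open>The quadratic is least at \<open>t = - d / \<parallel>x\<parallel>\<^sup>2\<close>; adding one to the denominator covers \<open>x = 0\<close>
      as well.\<close>
    define c where "c = (norm x)\<^sup>2"
    define s where "s = d / (c + 1)"
    have c: "0 \<le> c"
      by (simp add: c_def)
    then have d: "d = s * (c + 1)"
      by (simp add: s_def)
    have "0 \<le> 2 * (- s) * d + (- s)\<^sup>2 * c"
      using quadratic[of "- s"] by (simp add: c_def)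
    also have "\<dots> = - (s\<^sup>2 * (c + 2))"
      by (simp add: d power2_eq_square algebra_simps)
    finally have "s\<^sup>2 * (c + 2) \<le> 0"
      by simp
    then have "d = 0"
      using c by (simp add: d mult_le_0_iff)
    then show ?thesis
      by (simp add: d_def)
  qed
  then show ?thesis
    by (intro exI[of _ w]) blast
qed

section \<open>Unitary representations\<close>

lemma unitary_representationD:
  assumes "unitary_representation G T \<pi>" "x \<in> carrier G"
  shows "clinear_on UNIV (\<pi> x)" "surj (\<pi> x)" "cinner (\<pi> x u) (\<pi> x v) = cinner u v"
  using assms by (auto simp: unitary_representation_def hom_def unitary_group_def
      unitary_operator_def Pi_iff)

lemma unitary_representation_mult:
  assumes "unitary_representation G T \<pi>" "x \<in> carrier G" "y \<in> carrier G"
  shows "\<pi> (x \<otimes>\<^bsub>G\<^esub> y) u = \<pi> x (\<pi> y u)"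
  using assms by (auto simp: unitary_representation_def hom_def unitary_group_def)

context group
begin

lemma unitary_representation_one:
  assumes "unitary_representation G T \<pi>"
  shows "\<pi> \<one> u = u"
proof -
  obtain v where "u = \<pi> \<one> v"
    using unitary_representationD(2)[OF assms one_closed] by (rule surjE)
  then show ?thesis
    using unitary_representation_mult[OF assms one_closed one_closed, of v] by simp
qed

lemma cinner_inv_representation:
  assumes \<pi>: "unitary_representation G T \<pi>" and "y \<in> carrier G"
  shows "cinner f (\<pi> (inv y) u) = cinner (\<pi> y f) u"
proof -
  have "cinner f (\<pi> (inv y) u) = cinner (\<pi> y f) (\<pi> y (\<pi> (inv y) u))"
    using assms by (simp add: unitary_representationD(3))
  also have "\<pi> y (\<pi> (inv y) u) = u"
    using assms by (simp add: unitary_representation_one[OF \<pi>]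
        flip: unitary_representation_mult[OF \<pi>])
  finally show ?thesis .
qed

lemma wavelet_transform_inv_mult:
  assumes "unitary_representation G T \<pi>" "x \<in> carrier G" "y \<in> carrier G"
  shows "wavelet_transform \<pi> g f (inv y \<otimes> x) = wavelet_transform \<pi> g (\<pi> y f) x"
  using assms
  by (simp add: wavelet_transform_def unitary_representation_mult[OF assms(1)]
      cinner_inv_representation[OF assms(1)])

text \<open>The kernel \<open>\<W>\<^sub>g g (y\<^sup>-\<^sup>1 x)\<close> is \<open>\<langle>\<pi>(y)g, \<pi>(x)g\<rangle>\<close>, so its matrices are Gram matrices of the orbit
  of \<open>g\<close>.\<close>

lemma wavelet_transform_quadratic_form:
  assumes "unitary_representation G T \<pi>" "F \<subseteq> carrier G"
  shows "(\<Sum>x\<in>F. \<Sum>y\<in>F. cnj (v x) * wavelet_transform \<pi> g g (inv y \<otimes> x) * v y) =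
    complex_of_real ((norm (\<Sum>x\<in>F. v x *\<^sub>C \<pi> x g))\<^sup>2)"
proof -
  have "(\<Sum>x\<in>F. \<Sum>y\<in>F. cnj (v x) * wavelet_transform \<pi> g g (inv y \<otimes> x) * v y) =
      (\<Sum>x\<in>F. \<Sum>y\<in>F. cinner (v y *\<^sub>C \<pi> y g) (v x *\<^sub>C \<pi> x g))"
  proof (intro sum.cong refl)
    fix x y
    assume "x \<in> F" "y \<in> F"
    then have "wavelet_transform \<pi> g g (inv y \<otimes> x) = cinner (\<pi> y g) (\<pi> x g)"
      using assms(2) by (subst wavelet_transform_inv_mult[OF assms(1)])
        (auto simp: wavelet_transform_def)
    then show "cnj (v x) * wavelet_transform \<pi> g g (inv y \<otimes> x) * v y =
        cinner (v y *\<^sub>C \<pi> y g) (v x *\<^sub>C \<pi> x g)"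
      by (simp add: cinner_scaleC_left cinner_scaleC_right)
  qed
  then show ?thesis
    unfolding cinner_self[symmetric] by (simp add: cinner_sum_left cinner_sum_right)
qed

section \<open>Domination of matrix coefficients\<close>

lemma norm_le_if_positive_type_diff:
  assumes \<pi>: "unitary_representation G T \<pi>" and \<rho>: "unitary_representation G T \<rho>"
    and pos: "positive_type G (\<lambda>x. wavelet_transform \<pi> g g x - wavelet_transform \<rho> h h x)"
    and F: "finite F" "F \<subseteq> carrier G"
  shows "norm (\<Sum>x\<in>F. v x *\<^sub>C \<rho> x h) \<le> norm (\<Sum>x\<in>F. v x *\<^sub>C \<pi> x g)"
proof -
  let ?q = "\<lambda>\<phi>. \<Sum>x\<in>F. \<Sum>y\<in>F. cnj (v x) * \<phi> (inv y \<otimes> x) * v y"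
  have "?q (\<lambda>x. wavelet_transform \<pi> g g x - wavelet_transform \<rho> h h x) =
      ?q (wavelet_transform \<pi> g g) - ?q (wavelet_transform \<rho> h h)"
    by (simp add: right_diff_distrib left_diff_distrib sum_subtractf)
  also have "\<dots> = complex_of_real
      ((norm (\<Sum>x\<in>F. v x *\<^sub>C \<pi> x g))\<^sup>2 - (norm (\<Sum>x\<in>F. v x *\<^sub>C \<rho> x h))\<^sup>2)"
    by (simp only: wavelet_transform_quadratic_form[OF \<pi> F(2), of v g]
        wavelet_transform_quadratic_form[OF \<rho> F(2), of v h] of_real_diff)
  finally have eq: "?q (\<lambda>x. wavelet_transform \<pi> g g x - wavelet_transform \<rho> h h x) = \<dots>" .
  have "?q (\<lambda>x. wavelet_transform \<pi> g g x - wavelet_transform \<rho> h h x) \<in> \<real>\<^sub>\<ge>\<^sub>0"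
    using pos[unfolded positive_type_def pos_semidef_on_def] F by blast
  then have "(norm (\<Sum>x\<in>F. v x *\<^sub>C \<rho> x h))\<^sup>2 \<le> (norm (\<Sum>x\<in>F. v x *\<^sub>C \<pi> x g))\<^sup>2"
    unfolding eq nonneg_Reals_of_real_iff by simp
  then show ?thesis
    by (rule power2_le_imp_le) simp
qed

text \<open>Domination of the kernels is inclusion of the reproducing kernel Hilbert spaces: every
  transform \<open>\<W>\<^sub>h f\<close> is also a transform with window \<open>g\<close>. The new vector is the adjoint vector of \<open>f\<close>
  under the contraction that sends \<open>\<pi>(x)g\<close> to \<open>\<rho>(x)h\<close>.\<close>

lemma wavelet_transform_factorization:
  fixes \<pi> :: "'a \<Rightarrow> 'h::chilbert_space \<Rightarrow> 'h" and \<rho> :: "'a \<Rightarrow> 'k::chilbert_space \<Rightarrow> 'k"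
  assumes \<pi>: "unitary_representation G T \<pi>" and \<rho>: "unitary_representation G T \<rho>"
    and pos: "positive_type G (\<lambda>x. wavelet_transform \<pi> g g x - wavelet_transform \<rho> h h x)"
  shows "\<exists>w. \<forall>x\<in>carrier G. wavelet_transform \<pi> g w x = wavelet_transform \<rho> h f x"
proof -
  define q where "q = (\<lambda>F v. (\<Sum>x\<in>F. v x *\<^sub>C \<pi> x g, \<Sum>x\<in>F. v x *\<^sub>C \<rho> x h))"
  define R where "R = {q F v |F v. finite F \<and> F \<subseteq> carrier G}"
  \<comment> \<open>Coefficients on \<open>F\<close> are extended by zero, so that two combinations can be added over a common
    index set.\<close>
  have extend: "q F v = q (F \<union> F') (\<lambda>x. if x \<in> F then v x else 0)"
    if "finite F" "finite F'" for F F' v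
    unfolding q_def using that
    by (auto intro!: sum.mono_neutral_cong_left)
  have "subspace R"
  proof (rule subspaceI)
    show "0 \<in> R"
      unfolding R_def q_def by (auto simp: zero_prod_def intro!: exI[of _ "{}"])
  next
    fix r s
    assume "r \<in> R" "s \<in> R"
    then obtain F v F' v' where F: "finite F" "F \<subseteq> carrier G" "finite F'" "F' \<subseteq> carrier G"
      and "r = q F v" "s = q F' v'"
      unfolding R_def by blast
    then have "r + s = q (F \<union> F') (\<lambda>x. (if x \<in> F then v x else 0) + (if x \<in> F' then v' x else 0))"
      using extend[of F F' v] extend[of F' F v']
      by (simp add: q_def scaleC_add_left sum.distrib Un_commute)
    then show "r + s \<in> R"
      unfolding R_def using F by blast
  next
    fix c r
    assume "r \<in> R"
    then obtain F v where F: "finite F" "F \<subseteq> carrier G" and "r = q F v"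
      unfolding R_def by blast
    then have "c *\<^sub>R r = q F (\<lambda>x. complex_of_real c * v x)"
      by (simp add: q_def scaleR_sum_right) (simp add: scaleR_scaleC scaleC_scaleC)
    then show "c *\<^sub>R r \<in> R"
      unfolding R_def using F by blast
  qed
  moreover have "norm v \<le> norm u" if "(u, v) \<in> R" for u v
    using that norm_le_if_positive_type_diff[OF \<pi> \<rho> pos] by (auto simp: R_def q_def)
  ultimately obtain w where w: "\<forall>(u, v)\<in>R. inner w u = inner f v"
    using adjoint_vector_exists by blast
  have "inner w (a *\<^sub>C \<pi> x g) = inner f (a *\<^sub>C \<rho> x h)" if "x \<in> carrier G" for a x
  proof -
    have "(a *\<^sub>C \<pi> x g, a *\<^sub>C \<rho> x h) = q {x} (\<lambda>_. a)"
      by (simp add: q_def)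
    then have "(a *\<^sub>C \<pi> x g, a *\<^sub>C \<rho> x h) \<in> R"
      unfolding R_def using that by blast
    then show ?thesis
      using w by blast
  qed
  then show ?thesis
    unfolding wavelet_transform_def
    by (intro exI[of _ w] ballI cinner_eq_if_inner_eq_multiples)
qed

end

section \<open>Admissible vectors\<close>

lemma admissible_vector_cinner:
  assumes "admissible_vector M \<pi> g"
  shows "L2_inner M (wavelet_transform \<pi> g f\<^sub>1) (wavelet_transform \<pi> g f\<^sub>2) = cinner f\<^sub>1 f\<^sub>2"
proof -
  obtain C where C: "Duflo_Moore_operator M \<pi> C" "norm (C g) = 1"
    and "g \<in> Duflo_Moore_domain M \<pi>"
    using assms by (auto simp: admissible_vector_def Duflo_Moore_domain_def)
  then have "L2_inner M (wavelet_transform \<pi> g f\<^sub>1) (wavelet_transform \<pi> g f\<^sub>2) =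
      cinner f\<^sub>1 f\<^sub>2 * cnj (cinner (C g) (C g))"
    unfolding Duflo_Moore_operator_def Let_def by blast
  then show ?thesis
    by (simp add: cinner_self C(2))
qed

lemma cinner_eq_if_wavelet_transforms_eq:
  assumes g: "admissible_vector M \<pi> g" and h: "admissible_vector M \<rho> h"
    and eq: "\<And>x. x \<in> space M \<Longrightarrow> wavelet_transform \<pi> g w\<^sub>1 x = wavelet_transform \<rho> h f\<^sub>1 x"
      "\<And>x. x \<in> space M \<Longrightarrow> wavelet_transform \<pi> g w\<^sub>2 x = wavelet_transform \<rho> h f\<^sub>2 x"
  shows "cinner w\<^sub>1 w\<^sub>2 = cinner f\<^sub>1 f\<^sub>2"
proof -
  have "L2_inner M (wavelet_transform \<pi> g w\<^sub>1) (wavelet_transform \<pi> g w\<^sub>2) =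
      L2_inner M (wavelet_transform \<rho> h f\<^sub>1) (wavelet_transform \<rho> h f\<^sub>2)"
    unfolding L2_inner_def by (rule Bochner_Integration.integral_cong) (simp_all add: eq)
  then show ?thesis
    by (simp only: admissible_vector_cinner[OF g] admissible_vector_cinner[OF h])
qed

lemma admissible_vector_transform_inj:
  fixes \<pi> :: "'a \<Rightarrow> 'h::chilbert_space \<Rightarrow> 'h"
  assumes g: "admissible_vector M \<pi> g"
    and eq: "\<And>x. x \<in> space M \<Longrightarrow> wavelet_transform \<pi> g w\<^sub>1 x = wavelet_transform \<pi> g w\<^sub>2 x"
  shows "w\<^sub>1 = w\<^sub>2"
proof (rule eq_if_cinner_eq)
  show "cinner z w\<^sub>1 = cinner z w\<^sub>2" for z
    by (rule cinner_eq_if_wavelet_transforms_eq[OF g g]) (simp_all add: eq)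
qed

text \<open>The vector \<open>A f\<close> is determined by its transform, so linearity and equivariance of \<open>A\<close> can be
  read off from the transforms. Irreducibility then leaves no room for a proper range.\<close>

lemma (in group) wavelet_intertwiner_surj:
  fixes \<pi> :: "'a \<Rightarrow> 'h::chilbert_space \<Rightarrow> 'h" and \<rho> :: "'a \<Rightarrow> 'k::chilbert_space \<Rightarrow> 'k"
  assumes \<pi>: "unitary_representation G T \<pi>" and irr: "irreducible_representation G \<pi>"
    and \<rho>: "unitary_representation G T \<rho>"
    and M: "space M = carrier G"
    and g: "admissible_vector M \<pi> g" and h: "admissible_vector M \<rho> h"
    and A: "\<And>f x. x \<in> carrier G \<Longrightarrow> wavelet_transform \<pi> g (A f) x = wavelet_transform \<rho> h f x"
  shows "surj A"
proof -
  have eqI: "w = A f"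
    if "\<And>x. x \<in> carrier G \<Longrightarrow> wavelet_transform \<pi> g w x = wavelet_transform \<rho> h f x" for w f
    by (rule admissible_vector_transform_inj[OF g]) (simp add: M that A)
  have add: "A u + A v = A (u + v)" for u v
    using A by (intro eqI) (simp add: wavelet_transform_def cinner_add_left)
  have scale: "a *\<^sub>C A u = A (a *\<^sub>C u)" for a u
    using A by (intro eqI) (simp add: wavelet_transform_def cinner_scaleC_left)
  have intertwine: "\<pi> y (A u) = A (\<rho> y u)" if "y \<in> carrier G" for y u
  proof (rule eqI)
    fix x
    assume "x \<in> carrier G"
    then show "wavelet_transform \<pi> g (\<pi> y (A u)) x = wavelet_transform \<rho> h (\<rho> y u) x"
      using that A[of "inv y \<otimes> x"]
      by (simp flip: wavelet_transform_inv_mult[OF \<pi>] wavelet_transform_inv_mult[OF \<rho>])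
  qed
  have iso: "cinner (A u) (A v) = cinner u v" for u v
    using cinner_eq_if_wavelet_transforms_eq[OF g h] A M by simp
  have zero: "A 0 = 0"
    using scale[of 0 0] by simp
  have "csubspace (range A)"
    unfolding csubspace_def using zero by (auto simp: add scale)
  moreover have "closed (range A)"
    by (rule closed_range_if_cinner_preserving[OF _ iso]) (simp add: clinear_on_def add scale)
  moreover have "\<pi> x ` range A \<subseteq> range A" if "x \<in> carrier G" for x
    using intertwine[OF that] by auto
  ultimately have "range A = {0} \<or> range A = UNIV"
    using irr by (simp add: irreducible_representation_def)
  moreover have "A h \<noteq> 0"
  proof
    assume "A h = 0"
    then have "h = 0"
      using iso[of h h] by (simp add: cinner_self)
    then show False
      using h by (simp add: admissible_vector_def square_integrable_vector_def)
  qed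
  ultimately show ?thesis
    by blast
qed

theorem corollary1p2:
  fixes G :: "('a, 'b) monoid_scheme"
    and T :: "'a topology"
    and \<mu> :: "'a measure"
    and \<pi> :: "'a \<Rightarrow> 'h::chilbert_space \<Rightarrow> 'h"
    and \<rho> :: "'a \<Rightarrow> 'k::chilbert_space \<Rightarrow> 'k"
    and g :: 'h
    and h :: 'k
  assumes "locally_compact_group G T"
    and "left_Haar_measure G T \<mu>"
    and "square_integrable_representation G T \<mu> \<pi>"
    and "square_integrable_representation G T \<mu> \<rho>"
    and "admissible_vector \<mu> \<pi> g"
    and "admissible_vector \<mu> \<rho> h"
    and "positive_type G (\<lambda>x. wavelet_transform \<pi> g g x - wavelet_transform \<rho> h h x)"
  shows "\<forall>x\<in>carrier G. wavelet_transform \<pi> g g x - wavelet_transform \<rho> h h x = 0"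
proof -
  interpret locally_compact_group G T
    by fact
  have \<pi>: "unitary_representation G T \<pi>" "irreducible_representation G \<pi>"
    and \<rho>: "unitary_representation G T \<rho>"
    using assms(3,4) by (simp_all add: square_integrable_representation_def)
  have M: "space \<mu> = carrier G"
    using assms(2) topspace_eq_carrier by (simp add: left_Haar_measure_def Radon_measure_def)
  obtain A where A: "\<And>f x. x \<in> carrier G \<Longrightarrow>
      wavelet_transform \<pi> g (A f) x = wavelet_transform \<rho> h f x"
    using wavelet_transform_factorization[OF \<pi>(1) \<rho> assms(7)] by metis
  have "surj A"
    using wavelet_intertwiner_surj[OF \<pi> \<rho> M assms(5,6)] A by blast
  then obtain f where f: "g = A f"
    by (metis surjD)
  have "f = h"
  proof (rule eq_if_cinner_eq)
    fix f'
    have "cinner f' f = cinner (A f') (A f)"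
      using cinner_eq_if_wavelet_transforms_eq[OF assms(5,6)] A M by simp
    also have "\<dots> = wavelet_transform \<pi> g (A f') \<one>\<^bsub>G\<^esub>"
      using unitary_representation_one[OF \<pi>(1)] by (simp add: wavelet_transform_def flip: f)
    also have "\<dots> = cinner f' h"
      using unitary_representation_one[OF \<rho>] by (simp add: A) (simp add: wavelet_transform_def)
    finally show "cinner f' f = cinner f' h" .
  qed
  then show ?thesis
    using A[of _ h] f by simp
qed

end
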